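(* Let $f:\mathbb{R}^d\to\mathbb{R}$ be differentiable and $\mu$-strongly convex with $\mu>0$; let $x^\star$ be its minimizer and $f^\star:=f(x^\star)$. Suppose $f$ is matrix smooth with matrix $\mathbb{L}$ (as in the context), $L:=\|\mathbb{L}\|$, and suppose the random matrix $P\in\mathbb{R}^{d\times r}$ satisfies the sketch moment conditions (as in the context) with constants $\omega,\ell>0$. Let $\{x_k,y_k,z_k\}$ be generated by algorithm RS-NAG-SC (as in the context). Define $\Delta_0:=f(x_0)-f^\star$. Then the parameter $\theta=\sqrt{\mu/(L\omega\ell)}$ of the algorithm satisfies $\theta\in(0,1]$, and for all $N\ge0$, $$\mathbb{E}[f(x_N)-f^\star]\le 2(1-\theta)^N\Delta_0.$$ In particular, the iteration complexity to guarantee $\mathbb{E}[f(x_N)-f^\star]\le\epsilon$ is $$N=\mathcal{O}\!\left(\sqrt{\frac{L\omega\ell}{\mu}}\,\log\frac{\Delta_0}{\epsilon}\right),$$ and since one iteration uses $r$ oracle calls, the oracle complexity is $$\#\mathrm{Oracle}=rN=\mathcal{O}\!\left(\sqrt{\frac{L\omega\ell r^2}{\mu}}\,\log\frac{\Delta_0}{\epsilon}\right).$$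
   Context: Standing assumptions: $d\ge2$, $1\le r\le d$, and, without loss of generality, $\ell\le\omega$ (for any admissible $\omega$, the third sketch moment condition below holds with $\ell=\omega$). $\|\cdot\|$ is the Euclidean norm for vectors and the induced operator norm for matrices; $A\preceq B$ means that $B-A$ is positive semidefinite, for symmetric $A,B$. Matrix smoothness: $f$ is differentiable and there is a fixed matrix $\mathbb{L}\in\mathbb{R}^{d\times d}$, $\mathbb{L}\succeq0$, $\mathbb{L}\ne0$, such that for all $x,y\in\mathbb{R}^d$, $f(y)\le f(x)+\langle\nabla f(x),y-x\rangle+\tfrac12(y-x)^\top\mathbb{L}(y-x)$. Put $L:=\|\mathbb{L}\|$. Sketch moment conditions: $P\in\mathbb{R}^{d\times r}$ is a random matrix and $\omega>0$, $\ell>0$ are constants with $\mathbb{E}[PP^\top]=I_d$, $\mathbb{E}[(PP^\top)^2]\preceq\omega I_d$, $\mathbb{E}[PP^\top\mathbb{L}PP^\top]\preceq\ell L\,I_d$. Algorithm RS-NAG-SC: given $x_0\in\mathbb{R}^d$, the constants $L,\mu,\omega,\ell>0$, and a sequence $\{P_k\}_{k\ge0}$ of i.i.d. copies of $P$, set $\theta=\sqrt{\mu/(L\omega\ell)}$, $z_0=x_0$, and for $k=0,1,2,\dots$: $y_k=\dfrac1{1+\theta}x_k+\dfrac{\theta}{1+\theta}z_k$, $\quad x_{k+1}=y_k-\dfrac1{L\ell}P_kP_k^\top\nabla f(y_k)$, $\quad z_{k+1}=(1-\theta)z_k+\theta y_k-\dfrac{\theta}{\mu}P_kP_k^\top\nabla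 f(y_k)$. Oracle model: one oracle call is one directional-derivative evaluation; evaluating $P_k^\top\nabla f(y_k)$ costs $r$ calls. *)

theory Defs
  imports "HOL-Probability.Probability"
begin

text \<open>
  A real matrix of shape d by r has type \<open>real^'r^'d\<close> (rows are indexed by \<open>'d\<close>), with
  \<open>d = CARD('d)\<close> and \<open>r = CARD('r)\<close>. The library norm on this type is the Frobenius norm, so the
  induced operator norm of \<open>A\<close> is written \<open>onorm ((*v) A)\<close>.
\<close>

definition gradient :: "('a::real_inner \<Rightarrow> real) \<Rightarrow> 'a \<Rightarrow> 'a" where
  "gradient f x = (THE D. GDERIV f x :> D)"

lemma GDERIV_gradient:
  fixes f :: "'a::euclidean_space \<Rightarrow> real"
  assumes "f differentiable (at x)"
  shows "GDERIV f x :> gradient f x"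
proof -
  obtain F where F: "(f has_derivative F) (at x)"
    using assms unfolding differentiable_def by blast
  then interpret bounded_linear F
    by (rule has_derivative_bounded_linear)
  have "\<exists>D. F = (\<lambda>h. inner h D)"
    using adjoint_works[OF linear_axioms, of _ 1]
    by (intro exI[of _ "adjoint F 1"]) (simp add: fun_eq_iff)
  then obtain D0 where "F = (\<lambda>h. inner h D0)" ..
  then have G: "GDERIV f x :> D0"
    using F unfolding gderiv_def by simp
  have unique: "D = D'" if "GDERIV f x :> D" "GDERIV f x :> D'" for D D'
  proof -
    have "(\<lambda>h. inner h D) = (\<lambda>h. inner h D')"
      using that unfolding gderiv_def by (rule has_derivative_unique)
    then have "inner (D - D') D = inner (D - D') D'"
      by (rule fun_cong)
    then have "inner (D - D') (D - D') = 0"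
      by (simp only: inner_diff_right)
    then show ?thesis
      by simp
  qed
  show ?thesis
    unfolding gradient_def using G by (rule theI) (rule unique[OF _ G])
qed

definition strongly_convex :: "real \<Rightarrow> ('a::real_inner \<Rightarrow> real) \<Rightarrow> bool" where
  "strongly_convex \<mu> f \<longleftrightarrow>
     (\<forall>x y t. 0 \<le> t \<and> t \<le> 1 \<longrightarrow>
        f (t *\<^sub>R x + (1 - t) *\<^sub>R y)
          \<le> t * f x + (1 - t) * f y - \<mu> / 2 * t * (1 - t) * (norm (x - y))\<^sup>2)"

definition psd :: "real^'n^'n \<Rightarrow> bool" where
  "psd A \<longleftrightarrow> transpose A = A \<and> (\<forall>v. 0 \<le> v \<bullet> (A *v v))"

definition loewner_le :: "real^'n^'n \<Rightarrow> real^'n^'n \<Rightarrow> bool"  (infix \<open>\<preceq>\<close> 50) where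
  "A \<preceq> B \<longleftrightarrow> transpose A = A \<and> transpose B = B \<and> psd (B - A)"

definition matrix_smooth :: "(real^'d \<Rightarrow> real) \<Rightarrow> real^'d^'d \<Rightarrow> bool" where
  "matrix_smooth f LL \<longleftrightarrow>
     (\<forall>x. f differentiable (at x)) \<and> psd LL \<and> LL \<noteq> 0 \<and>
     (\<forall>x y. f y \<le> f x + gradient f x \<bullet> (y - x) + 1 / 2 * ((y - x) \<bullet> (LL *v (y - x))))"

text \<open>
  The expectation of a random matrix is the Bochner integral in the matrix space, i.e. the entrywise
  expectation. A Bochner integral of a non-integrable function is \<open>0\<close>, so the existence of each
  moment is required explicitly.
\<close>

definition sketch_moments ::
    "'w measure \<Rightarrow> ('w \<Rightarrow> real^'r^'d) \<Rightarrow> real^'d^'d \<Rightarrow> real \<Rightarrow> real \<Rightarrow> bool" where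
  "sketch_moments M P LL \<omega> l \<longleftrightarrow>
     prob_space M \<and> P \<in> borel_measurable M \<and> 0 < \<omega> \<and> 0 < l \<and>
     (let S = (\<lambda>w. P w ** transpose (P w)) in
        integrable M S \<and>
        (\<integral>w. S w \<partial>M) = mat 1 \<and>
        integrable M (\<lambda>w. S w ** S w) \<and>
        (\<integral>w. S w ** S w \<partial>M) \<preceq> mat \<omega> \<and>
        integrable M (\<lambda>w. S w ** LL ** S w) \<and>
        (\<integral>w. S w ** LL ** S w \<partial>M) \<preceq> mat (l * onorm ((*v) LL)))"

definition iid_copies ::
    "'w measure \<Rightarrow> (nat \<Rightarrow> 'w \<Rightarrow> 'b::topological_space) \<Rightarrow> 'v measure \<Rightarrow> ('v \<Rightarrow> 'b) \<Rightarrow> bool" where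
  "iid_copies M X M' Y \<longleftrightarrow>
     prob_space.indep_vars M (\<lambda>_. borel) X UNIV \<and>
     (\<forall>k. distr M borel (X k) = distr M' borel Y)"

definition step_theta :: "real \<Rightarrow> real \<Rightarrow> real \<Rightarrow> real \<Rightarrow> real" where
  "step_theta L \<mu> \<omega> l = sqrt (\<mu> / (L * \<omega> * l))"

text \<open>
  A single (pathwise) run: \<open>P\<close> is a realization of the sequence of sketches, \<open>g\<close> is the gradient
  of the objective. The three sequences are uniquely determined by the remaining arguments.
\<close>

definition rs_nag_sc ::
    "(real^'d \<Rightarrow> real^'d) \<Rightarrow> real^'d \<Rightarrow> real \<Rightarrow> real \<Rightarrow> real \<Rightarrow> real \<Rightarrow> (nat \<Rightarrow> real^'r^'d) \<Rightarrow>
     (nat \<Rightarrow> real^'d) \<Rightarrow> (nat \<Rightarrow> real^'d) \<Rightarrow> (nat \<Rightarrow> real^'d) \<Rightarrow> bool" where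
  "rs_nag_sc g x0 L \<mu> \<omega> l P x y z \<longleftrightarrow>
     (let \<theta> = step_theta L \<mu> \<omega> l in
        x 0 = x0 \<and> z 0 = x0 \<and>
        (\<forall>k. y k = (1 / (1 + \<theta>)) *\<^sub>R x k + (\<theta> / (1 + \<theta>)) *\<^sub>R z k \<and>
             x (Suc k) = y k - (1 / (L * l)) *\<^sub>R (P k *v (transpose (P k) *v g (y k))) \<and>
             z (Suc k) = (1 - \<theta>) *\<^sub>R z k + \<theta> *\<^sub>R y k
                           - (\<theta> / \<mu>) *\<^sub>R (P k *v (transpose (P k) *v g (y k)))))"

text \<open>
  One oracle call is one directional derivative. Iteration \<open>k\<close> evaluates \<open>P\<^sub>k\<^sup>T \<nabla>f(y\<^sub>k)\<close>, whose
  entries are the directional derivatives at \<open>y\<^sub>k\<close> along the columns of \<open>P\<^sub>k\<close>, so a call is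
  identified by the pair of the iteration and the column index.
\<close>

definition oracle_calls :: "'r::finite itself \<Rightarrow> nat \<Rightarrow> nat" where
  "oracle_calls _ N = card ({..<N} \<times> (UNIV :: 'r set))"

end

theory Submission
  imports Defs
begin

text \<open>
  The potential \<open>f(x) - f\<^sup>\<star> + \<mu>/2 |z - x\<^sup>\<star>|\<^sup>2\<close> contracts by the factor \<open>1 - \<theta>\<close> in expectation over a
  single sketch: the decrease of \<open>f\<close> guaranteed by matrix smoothness and the third moment condition
  cancels the second-order term of the \<open>z\<close>-update controlled by the second one, and strong convexity
  at \<open>y\<^sub>k\<close> bounds what is left. Since \<open>(x\<^sub>k, z\<^sub>k)\<close> depends only on the sketches before \<open>P\<^sub>k\<close>, it is
  independent of \<open>P\<^sub>k\<close>; as the potential is nonnegative, Tonelli's theorem carries the one-step bound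
  over to the whole run, and integrability comes out as a by-product. Finally \<open>\<theta> \<le> 1\<close> follows from
  \<open>\<omega> \<ge> 1\<close> (as \<open>E[(S - I)\<^sup>2]\<close> is positive semidefinite for \<open>S = P P\<^sup>T\<close>) and from
  \<open>\<mu> |v|\<^sup>2 \<le> v\<^sup>T LL v \<le> E[v\<^sup>T S LL S v] \<le> l L |v|\<^sup>2\<close>.
\<close>

section \<open>Random iterations driven by independent inputs\<close>

primrec random_iterate :: "('p \<Rightarrow> 's \<Rightarrow> 's) \<Rightarrow> 's \<Rightarrow> (nat \<Rightarrow> 'p) \<Rightarrow> nat \<Rightarrow> 's" where
  "random_iterate T s p 0 = s"
| "random_iterate T s p (Suc k) = T (p k) (random_iterate T s p k)"

lemma random_iterate_cong:
  "(\<And>i. i < k \<Longrightarrow> p i = q i) \<Longrightarrow> random_iterate T s p k = random_iterate T s q k"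
  by (induction k) auto

text \<open>With \<open>I = {..<k}\<close> this exhibits the state after \<open>k\<close> steps as a
  measurable function of the past inputs alone, which is what independence is applied to.\<close>

lemma measurable_random_iterate_PiM:
  assumes T: "(\<lambda>(s, p). T p s) \<in> measurable (N \<Otimes>\<^sub>M K) N" and s: "s \<in> space N"
    and k: "{..<k} \<subseteq> I"
  shows "(\<lambda>p. random_iterate T s p k) \<in> measurable (PiM I (\<lambda>_. K)) N"
  using k
proof (induction k)
  case 0
  then show ?case using s by simp
next
  case (Suc k)
  then have "{..<k} \<subseteq> I" "k \<in> I"
    by auto
  with Suc.IH have "(\<lambda>p. (random_iterate T s p k, p k)) \<in> measurable (PiM I (\<lambda>_. K)) (N \<Otimes>\<^sub>M K)"
    by (intro measurable_Pair measurable_component_singleton) auto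
  from measurable_compose[OF this T] show ?case
    by simp
qed

context prob_space
begin

lemma measurable_random_iterate:
  assumes T: "(\<lambda>(s, p). T p s) \<in> measurable (N \<Otimes>\<^sub>M K) N" and s: "s \<in> space N"
    and X: "\<And>i. X i \<in> measurable M K"
  shows "(\<lambda>w. random_iterate T s (\<lambda>i. X i w) k) \<in> measurable M N"
proof (induction k)
  case 0
  then show ?case using s by simp
next
  case (Suc k)
  have "(\<lambda>w. (random_iterate T s (\<lambda>i. X i w) k, X k w)) \<in> measurable M (N \<Otimes>\<^sub>M K)"
    by (intro measurable_Pair Suc X)
  from measurable_compose[OF this T] show ?case
    by simp
qed

text \<open>The state before step \<open>k\<close> is built from the inputs below \<open>k\<close>,
  hence independent of \<open>X k\<close>: freeze it, integrate over \<open>X k\<close> first, and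
  apply the contraction pointwise. With values in \<open>ennreal\<close>, Tonelli needs no
  integrability.\<close>

lemma nn_integral_random_iterate_le:
  fixes V :: "'s \<Rightarrow> ennreal"
  assumes T: "(\<lambda>(s, p). T p s) \<in> measurable (N \<Otimes>\<^sub>M K) N" and s: "s \<in> space N"
    and X: "indep_vars (\<lambda>_. K) X UNIV"
    and V: "V \<in> borel_measurable N"
    and contract: "\<And>i t. t \<in> space N \<Longrightarrow> (\<integral>\<^sup>+p. V (T p t) \<partial>distr M K (X i)) \<le> c * V t"
  shows "(\<integral>\<^sup>+w. V (random_iterate T s (\<lambda>i. X i w) k) \<partial>M) \<le> c ^ k * V s"
proof (induction k)
  case 0
  then show ?case by (simp add: emeasure_space_1)
next
  case (Suc k)
  let ?F = "\<lambda>q. random_iterate T s q k"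
  \<comment> \<open>The past and the current input are two disjoint blocks of one independent
    family; the current one is a block with the single index \<open>k\<close>.\<close>
  let ?Q = "\<lambda>w. restrict (\<lambda>i. X i w) {..<k}" and ?PQ = "PiM {..<k} (\<lambda>_. K)"
  let ?R = "\<lambda>w. restrict (\<lambda>i. X i w) {k}" and ?PR = "PiM {k} (\<lambda>_. K)"
  let ?h = "\<lambda>z. V (T (snd z k) (?F (fst z)))"
  have FQ: "?F (?Q w) = random_iterate T s (\<lambda>i. X i w) k" for w
    by (rule random_iterate_cong) simp
  have F: "?F \<in> measurable ?PQ N"
    by (rule measurable_random_iterate_PiM[OF T s order_refl])
  have ind: "indep_var ?PQ ?Q ?PR ?R"
    by (rule indep_var_restrict[OF X]) auto
  then have Q: "?Q \<in> measurable M ?PQ" and R: "?R \<in> measurable M ?PR"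
    by (blast dest: indep_var_rv1 indep_var_rv2)+
  have Xk: "X k \<in> measurable M K"
    using X by (simp add: indep_vars_def)
  interpret R: prob_space "distr M ?PR ?R" by (rule prob_space_distr[OF R])
  have Rk: "(\<lambda>r. r k) \<in> measurable ?PR K"
    by (rule measurable_component_singleton) simp
  have FR: "(\<lambda>z. (?F (fst z), snd z k)) \<in> measurable (?PQ \<Otimes>\<^sub>M ?PR) (N \<Otimes>\<^sub>M K)"
    by (intro measurable_Pair measurable_compose[OF measurable_fst F]
        measurable_compose[OF measurable_snd Rk])
  have TV: "(\<lambda>(t, p). V (T p t)) \<in> borel_measurable (N \<Otimes>\<^sub>M K)"
    using measurable_compose[OF T V] by (simp add: case_prod_unfold)
  have h: "?h \<in> borel_measurable (?PQ \<Otimes>\<^sub>M ?PR)"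
    using measurable_compose[OF FR TV] by simp
  have "(\<integral>\<^sup>+w. V (random_iterate T s (\<lambda>i. X i w) (Suc k)) \<partial>M) = (\<integral>\<^sup>+w. ?h (?Q w, ?R w) \<partial>M)"
    by (simp add: FQ)
  also have "\<dots> = (\<integral>\<^sup>+z. ?h z \<partial>distr M (?PQ \<Otimes>\<^sub>M ?PR) (\<lambda>w. (?Q w, ?R w)))"
    using h by (intro nn_integral_distr[symmetric] measurable_Pair Q R) simp
  also have "\<dots> = (\<integral>\<^sup>+z. ?h z \<partial>(distr M ?PQ ?Q \<Otimes>\<^sub>M distr M ?PR ?R))"
    using ind by (simp add: indep_var_distribution_eq)
  also have "\<dots> = (\<integral>\<^sup>+q. (\<integral>\<^sup>+r. ?h (q, r) \<partial>distr M ?PR ?R) \<partial>distr M ?PQ ?Q)"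
    using h by (subst R.nn_integral_fst[symmetric])
      (simp_all cong: measurable_cong_sets sets_pair_measure_cong)
  also have "\<dots> \<le> (\<integral>\<^sup>+q. c * V (?F q) \<partial>distr M ?PQ ?Q)"
  proof (rule nn_integral_mono)
    fix q assume "q \<in> space (distr M ?PQ ?Q)"
    then have q: "?F q \<in> space N"
      using measurable_space[OF F] by simp
    have VT: "(\<lambda>p. V (T p (?F q))) \<in> borel_measurable K"
      using measurable_compose[OF measurable_Pair1'[OF q] TV] by simp
    \<comment> \<open>For fixed \<open>q\<close> the integrand sees only coordinate
      \<open>k\<close>, so the law of the singleton block reduces to that of
      \<open>X k\<close>.\<close>
    have "(\<integral>\<^sup>+r. ?h (q, r) \<partial>distr M ?PR ?R) = (\<integral>\<^sup>+w. V (T (X k w) (?F q)) \<partial>M)"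
      using measurable_compose[OF Rk VT] R by (subst nn_integral_distr) simp_all
    also have "\<dots> = (\<integral>\<^sup>+p. V (T p (?F q)) \<partial>distr M K (X k))"
      using VT by (intro nn_integral_distr[OF Xk, symmetric]) simp
    also have "\<dots> \<le> c * V (?F q)"
      by (rule contract[OF q])
    finally show "(\<integral>\<^sup>+r. ?h (q, r) \<partial>distr M ?PR ?R) \<le> c * V (?F q)" .
  qed
  also have "\<dots> = c * (\<integral>\<^sup>+w. V (random_iterate T s (\<lambda>i. X i w) k) \<partial>M)"
    using Q measurable_compose[OF F V] by (simp add: nn_integral_cmult nn_integral_distr FQ)
  also have "\<dots> \<le> c * (c ^ k * V s)"
    by (intro mult_left_mono Suc) simp
  finally show ?case by (simp add: mult.assoc)
qed

end

section \<open>Strong convexity and gradients\<close>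

lemma DERIV_along_line:
  fixes f :: "'a::euclidean_space \<Rightarrow> real"
  assumes "f differentiable (at x)"
  shows "((\<lambda>t. f (x + t *\<^sub>R h)) has_real_derivative gradient f x \<bullet> h) (at 0)"
proof -
  have "((\<lambda>t. f (x + t *\<^sub>R h)) has_derivative (\<lambda>t. (t *\<^sub>R h) \<bullet> gradient f x)) (at 0)"
    using GDERIV_gradient[OF assms] unfolding gderiv_def
    by (intro has_derivative_compose[where f="\<lambda>t::real. x + t *\<^sub>R h" and g=f])
       (auto intro!: derivative_eq_intros)
  then show ?thesis
    by (simp add: has_field_derivative_def inner_commute mult_commute_abs)
qed

text \<open>Divide the defining inequality on the segment from \<open>x\<close> to \<open>y\<close>
  by \<open>t\<close> and let \<open>t\<close> tend to 0 from the right; \<open>?q\<close> is the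
  quotient plus the quadratic term, bounded by \<open>f y - f x\<close> on (0,1).\<close>

lemma strongly_convex_gradient_le:
  fixes f :: "'a::euclidean_space \<Rightarrow> real"
  assumes sc: "strongly_convex \<mu> f" and d: "f differentiable (at x)"
  shows "f x + gradient f x \<bullet> (y - x) + \<mu> / 2 * (norm (y - x))\<^sup>2 \<le> f y"
proof -
  let ?q = "\<lambda>t. (f (x + t *\<^sub>R (y - x)) - f x) / t + \<mu> / 2 * (1 - t) * (norm (y - x))\<^sup>2"
  have "((\<lambda>t. (f (x + t *\<^sub>R (y - x)) - f x) / t) \<longlongrightarrow> gradient f x \<bullet> (y - x)) (at 0)"
    using DERIV_along_line[OF d, of "y - x"] by (simp add: DERIV_def)
  then have "((\<lambda>t. (f (x + t *\<^sub>R (y - x)) - f x) / t) \<longlongrightarrow> gradient f x \<bullet> (y - x)) (at_right 0)"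
    by (rule tendsto_mono[OF at_le, rotated]) simp
  then have "(?q \<longlongrightarrow> gradient f x \<bullet> (y - x) + \<mu> / 2 * (1 - 0) * (norm (y - x))\<^sup>2) (at_right 0)"
    by (intro tendsto_intros)
  moreover have "eventually (\<lambda>t. ?q t \<le> f y - f x) (at_right 0)"
    unfolding eventually_at_right_field
  proof (intro exI[of _ 1] conjI allI impI)
    fix t :: real assume t: "0 < t" "t < 1"
    have "f (x + t *\<^sub>R (y - x)) = f (t *\<^sub>R y + (1 - t) *\<^sub>R x)"
      by (simp add: algebra_simps)
    also have "\<dots> \<le> t * f y + (1 - t) * f x - \<mu> / 2 * t * (1 - t) * (norm (y - x))\<^sup>2"
      using sc t unfolding strongly_convex_def by simp
    finally have "f (x + t *\<^sub>R (y - x)) - f x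
        \<le> t * (f y - f x - \<mu> / 2 * (1 - t) * (norm (y - x))\<^sup>2)"
      by (simp add: algebra_simps)
    then have "(f (x + t *\<^sub>R (y - x)) - f x) / t \<le> f y - f x - \<mu> / 2 * (1 - t) * (norm (y - x))\<^sup>2"
      using t by (simp add: field_simps)
    then show "?q t \<le> f y - f x" by simp
  qed simp
  ultimately have "gradient f x \<bullet> (y - x) + \<mu> / 2 * (1 - 0) * (norm (y - x))\<^sup>2 \<le> f y - f x"
    by (rule tendsto_upperbound) simp
  then show ?thesis by simp
qed

lemma gradient_at_minimizer:
  fixes f :: "'a::euclidean_space \<Rightarrow> real"
  assumes d: "f differentiable (at x)" and min: "\<And>y. f x \<le> f y"
  shows "gradient f x = 0"
proof -
  \<comment> \<open>The derivative in the direction of the gradient is the squared norm of the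
    gradient, and it vanishes at a minimum.\<close>
  have "gradient f x \<bullet> gradient f x = 0"
    using DERIV_along_line[OF d, of "gradient f x"] min
    by (intro DERIV_local_min[of "\<lambda>t. f (x + t *\<^sub>R gradient f x)" _ 0 1]) auto
  then show ?thesis by simp
qed

text \<open>Continuity of the gradient is not assumed; each component is a pointwise limit of
  difference quotients of the continuous \<open>f\<close>.\<close>

lemma borel_measurable_gradient:
  fixes f :: "'a::euclidean_space \<Rightarrow> real"
  assumes d: "\<And>x. f differentiable (at x)"
  shows "gradient f \<in> borel_measurable borel"
proof (rule borel_measurable_euclidean_space[THEN iffD2], rule ballI)
  fix b :: 'a assume "b \<in> Basis"
  have f: "f \<in> borel_measurable borel"
    by (intro borel_measurable_continuous_onI continuous_at_imp_continuous_on ballI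
        differentiable_imp_continuous_within d)
  show "(\<lambda>x. gradient f x \<bullet> b) \<in> borel_measurable borel"
  proof (rule borel_measurable_LIMSEQ_real)
    fix x
    have "filterlim (\<lambda>n. inverse (real (Suc n))) (at 0) sequentially"
      by (intro filterlim_atI LIMSEQ_inverse_real_of_nat always_eventually) simp
    then show "(\<lambda>n. (f (x + inverse (real (Suc n)) *\<^sub>R b) - f x) / inverse (real (Suc n)))
        \<longlonglongrightarrow> gradient f x \<bullet> b"
      using DERIV_along_line[OF d, of x b] unfolding DERIV_def
      by (auto intro: filterlim_compose)
  next
    fix n
    show "(\<lambda>x. (f (x + inverse (real (Suc n)) *\<^sub>R b) - f x) / inverse (real (Suc n)))
        \<in> borel_measurable borel"
      using f by measurable
  qed
qed

section \<open>Moments of the sketch\<close>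

lemma bounded_linear_quadratic_form:
  "bounded_linear (\<lambda>A. u \<bullet> (A *v v) :: real)" for u :: "real^'n" and v :: "real^'m"
  by (intro linear_conv_bounded_linear[THEN iffD1] linearI)
     (simp_all add: matrix_vector_mult_add_rdistrib inner_add_right scaleR_matrix_vector_assoc[symmetric])

lemma
  fixes A :: "'v \<Rightarrow> real^'m^'n"
  assumes "integrable M A"
  shows integrable_quadratic_form: "integrable M (\<lambda>w. u \<bullet> (A w *v v))"
    and integral_quadratic_form: "(\<integral>w. u \<bullet> (A w *v v) \<partial>M) = u \<bullet> ((\<integral>w. A w \<partial>M) *v v)"
  using integrable_bounded_linear[OF bounded_linear_quadratic_form assms]
    integral_bounded_linear[OF bounded_linear_quadratic_form assms] by auto

lemma mat_scalar_mult_vec: "mat c *v v = c *\<^sub>R v" for v :: "real^'n"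
  by (simp add: vec_eq_iff mat_def matrix_vector_mult_def if_distribR if_distrib[of "\<lambda>x. x * _"]
      cong: if_cong)

lemma loewner_le_mat_quadratic:
  assumes "A \<preceq> mat c"
  shows "v \<bullet> (A *v v) \<le> c * (norm v)\<^sup>2"
proof -
  have "0 \<le> v \<bullet> ((mat c - A) *v v)"
    using assms by (simp add: loewner_le_def psd_def)
  then show ?thesis
    by (simp add: matrix_vector_mult_diff_rdistrib inner_diff_right mat_scalar_mult_vec
        power2_norm_eq_inner)
qed

lemma psd_mat_1: "psd (mat 1)"
  by (simp add: psd_def)

lemma inner_symmetric_matrix:
  fixes A :: "real^'n^'n"
  assumes "transpose A = A"
  shows "u \<bullet> (A *v v) = (A *v u) \<bullet> v"
  using assms dot_lmul_matrix[of u A v] transpose_matrix_vector[of A u] by simp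

text \<open>A Jensen-type bound: expand E[(Sv - v)^T A (Sv - v)] >= 0. Since E[S] = I, the cross
  term averages to -2 v^T A v, leaving E[v^T S A S v] - v^T A v.\<close>

lemma psd_quadratic_le_sketched:
  fixes S :: "'v \<Rightarrow> real^'n^'n"
  assumes "prob_space M" and A: "psd A"
    and sym: "\<And>w. transpose (S w) = S w"
    and S: "integrable M S" "(\<integral>w. S w \<partial>M) = mat 1"
    and SAS: "integrable M (\<lambda>w. S w ** A ** S w)"
  shows "v \<bullet> (A *v v) \<le> v \<bullet> ((\<integral>w. S w ** A ** S w \<partial>M) *v v)"
proof -
  interpret prob_space M by fact
  have symA: "transpose A = A" and posA: "\<And>v. 0 \<le> v \<bullet> (A *v v)"
    using A by (auto simp: psd_def)
  have "0 \<le> (\<integral>w. v \<bullet> ((S w ** A ** S w) *v v) - 2 * ((A *v v) \<bullet> (S w *v v)) + v \<bullet> (A *v v) \<partial>M)"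
  proof (rule Bochner_Integration.integral_nonneg)
    fix w
    have "0 \<le> (S w *v v - v) \<bullet> (A *v (S w *v v - v))"
      by (rule posA)
    also have "\<dots> = v \<bullet> ((S w ** A ** S w) *v v) - 2 * ((A *v v) \<bullet> (S w *v v)) + v \<bullet> (A *v v)"
      using inner_symmetric_matrix[OF sym, of v w "A *v (S w *v v)"]
        inner_symmetric_matrix[OF symA, of v "S w *v v"]
      by (simp add: matrix_vector_mult_diff_distrib inner_diff matrix_vector_mul_assoc[symmetric]
          inner_commute)
    finally show "0 \<le> v \<bullet> ((S w ** A ** S w) *v v) - 2 * ((A *v v) \<bullet> (S w *v v)) + v \<bullet> (A *v v)" .
  qed
  also have "\<dots> = v \<bullet> ((\<integral>w. S w ** A ** S w \<partial>M) *v v) - v \<bullet> (A *v v)"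
    using SAS S
    by (simp add: integrable_quadratic_form integral_quadratic_form inner_commute prob_space)
  finally show ?thesis by simp
qed

section \<open>One step of the accelerated method\<close>

text \<open>The deterministic part of the contraction, with \<open>u\<close> the
  \<open>z\<close>-update before its gradient term. Strong convexity at \<open>y\<close> is used
  towards \<open>s\<close> with weight \<theta> and towards \<open>x\<close> with weight 1 -
  \<theta>.\<close>

lemma accelerated_step_descent:
  fixes x y z s g :: "'a::real_inner" and f :: "'a \<Rightarrow> real"
  assumes sc: "\<And>v. f y + g \<bullet> (v - y) + \<mu> / 2 * (norm (v - y))\<^sup>2 \<le> f v"
    and \<mu>: "0 \<le> \<mu>" and \<theta>: "0 < \<theta>" "\<theta> \<le> 1"
    and y: "y = (1 / (1 + \<theta>)) *\<^sub>R x + (\<theta> / (1 + \<theta>)) *\<^sub>R z"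
    and u: "u = (1 - \<theta>) *\<^sub>R z + \<theta> *\<^sub>R y"
  shows "f y - f s + \<mu> / 2 * (norm (u - s))\<^sup>2 - \<theta> * ((u - s) \<bullet> g)
    \<le> (1 - \<theta>) * (f x - f s + \<mu> / 2 * (norm (z - s))\<^sup>2)"
proof -
  define a e where "a = y - s" and "e = z - y"
  have "(1 + \<theta>) *\<^sub>R y = x + \<theta> *\<^sub>R z"
    unfolding y using \<theta> by (simp add: scaleR_add_right)
  \<comment> \<open>This is what the coupling weights of \<open>y\<close> are for: the term in g . e
    coming from \<open>x\<close> matches the one in \<open>ug\<close>.\<close>
  then have x: "x - y = - \<theta> *\<^sub>R e"
    by (simp add: e_def algebra_simps)
  have us: "u - s = a + (1 - \<theta>) *\<^sub>R e" and zs: "z - s = a + e"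
    by (simp_all add: u a_def e_def algebra_simps)
  \<comment> \<open>Here u - s = (1 - \<theta>)(z - s) + \<theta> a, and the squared norm of a
    convex combination is the combination of the squared norms minus \<theta>(1 - \<theta>) times
    the squared distance, which is |e|^2.\<close>
  have quad: "(norm (u - s))\<^sup>2
      = (1 - \<theta>) * (norm (z - s))\<^sup>2 + \<theta> * (norm a)\<^sup>2 - \<theta> * (1 - \<theta>) * (norm e)\<^sup>2"
    unfolding us zs power2_norm_eq_inner by (simp add: inner_simps inner_commute algebra_simps)
  have "f y - g \<bullet> a + \<mu> / 2 * (norm a)\<^sup>2 \<le> f s"
    using sc[of s] by (simp add: a_def norm_minus_commute inner_diff_right)
  then have 1: "\<theta> * (f y - g \<bullet> a + \<mu> / 2 * (norm a)\<^sup>2) \<le> \<theta> * f s"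
    using \<theta> by simp
  have "f y + g \<bullet> (x - y) \<le> f x"
    using sc[of x] \<mu> by (smt (verit) mult_nonneg_nonneg zero_le_power2 divide_nonneg_pos)
  then have 2: "(1 - \<theta>) * (f y - \<theta> * (g \<bullet> e)) \<le> (1 - \<theta>) * f x"
    using \<theta> unfolding x by (intro mult_left_mono) simp_all
  have 3: "0 \<le> \<mu> / 2 * (\<theta> * (1 - \<theta>) * (norm e)\<^sup>2)"
    using \<mu> \<theta> by simp
  have ug: "(u - s) \<bullet> g = g \<bullet> a + (1 - \<theta>) * (g \<bullet> e)"
    unfolding us by (simp add: inner_simps inner_commute)
  define m where "m = \<mu> / 2"
  show ?thesis
    using 1 2 3 unfolding quad ug m_def[symmetric] by (simp add: algebra_simps)
qed

section \<open>The algorithm as a random iteration on pairs (x, z)\<close>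

definition nag_mid :: "real \<Rightarrow> 'a::real_vector \<times> 'a \<Rightarrow> 'a" where
  "nag_mid \<theta> s = (1 / (1 + \<theta>)) *\<^sub>R fst s + (\<theta> / (1 + \<theta>)) *\<^sub>R snd s"

text \<open>\<open>y\<close> is a function of the pair (x, z), so this pair is a complete state and
  the sketch \<open>p\<close> is the only fresh input of a step.\<close>

definition nag_step ::
    "(real^'d \<Rightarrow> real^'d) \<Rightarrow> real \<Rightarrow> real \<Rightarrow> real \<Rightarrow> real^'r^'d \<Rightarrow>
     (real^'d) \<times> (real^'d) \<Rightarrow> (real^'d) \<times> (real^'d)" where
  "nag_step g \<theta> \<alpha> \<beta> p s =
     (let y = nag_mid \<theta> s; d = p *v (transpose p *v g y)
      in (y - \<alpha> *\<^sub>R d, (1 - \<theta>) *\<^sub>R snd s + \<theta> *\<^sub>R y - \<beta> *\<^sub>R d))"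

lemma rs_nag_sc_eq_random_iterate:
  assumes "rs_nag_sc g x0 L \<mu> \<omega> l P x y z"
  shows "(x k, z k)
    = random_iterate (nag_step g (step_theta L \<mu> \<omega> l) (1 / (L * l)) (step_theta L \<mu> \<omega> l / \<mu>)) (x0, x0) P k"
proof (induction k)
  case 0
  then show ?case using assms by (simp add: rs_nag_sc_def Let_def)
next
  case (Suc k)
  let ?T = "nag_step g (step_theta L \<mu> \<omega> l) (1 / (L * l)) (step_theta L \<mu> \<omega> l / \<mu>)"
  have "random_iterate ?T (x0, x0) P (Suc k) = ?T (P k) (x k, z k)"
    by (simp only: random_iterate.simps Suc)
  also have "\<dots> = (x (Suc k), z (Suc k))"
    using assms by (simp add: rs_nag_sc_def nag_step_def nag_mid_def Let_def)
  finally show ?case ..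
qed

lemma borel_measurable_sketch_mult:
  fixes p :: "'a \<Rightarrow> real^'r^'d" and v :: "'a \<Rightarrow> real^'d"
  assumes "p \<in> borel_measurable M" "v \<in> borel_measurable M"
  shows "(\<lambda>w. p w *v (transpose (p w) *v v w)) \<in> borel_measurable M"
  using assms
proof (rule borel_measurable_continuous_Pair)
  show "continuous_on UNIV (\<lambda>z. fst z *v (transpose (fst z) *v snd z) :: real^'d)"
    unfolding matrix_vector_mult_def transpose_def
    by (intro continuous_intros)
qed

lemma borel_measurable_nag_step:
  fixes g :: "real^'d \<Rightarrow> real^'d"
  assumes g: "g \<in> borel_measurable borel"
  shows "(\<lambda>(s, p :: real^'r^'d). nag_step g \<theta> \<alpha> \<beta> p s) \<in> measurable (borel \<Otimes>\<^sub>M borel) borel"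
proof -
  have mid: "(\<lambda>z :: ((real^'d) \<times> (real^'d)) \<times> (real^'r^'d). nag_mid \<theta> (fst z)) \<in> borel_measurable (borel \<Otimes>\<^sub>M borel)"
    unfolding nag_mid_def borel_prod
    by (intro borel_measurable_continuous_onI continuous_intros)
  have d: "(\<lambda>z. snd z *v (transpose (snd z :: real^'r^'d) *v g (nag_mid \<theta> (fst z)))) \<in> borel_measurable (borel \<Otimes>\<^sub>M borel)"
    by (intro borel_measurable_sketch_mult measurable_compose[OF mid g] measurable_snd)
  have snd: "(\<lambda>z :: ((real^'d) \<times> (real^'d)) \<times> (real^'r^'d). snd (fst z)) \<in> borel_measurable (borel \<Otimes>\<^sub>M borel)"
    unfolding borel_prod by (intro borel_measurable_continuous_onI continuous_intros)
  show ?thesis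
    unfolding nag_step_def Let_def case_prod_unfold
    by (intro borel_measurable_Pair borel_measurable_diff borel_measurable_add
        borel_measurable_scaleR borel_measurable_const mid d snd)
qed

section \<open>Constants and convergence\<close>

text \<open>\<open>M\<close> carries a single model sketch and \<open>s\<close> is the minimizer;
  the space on which the whole run lives enters only in \<open>expected_gap_le\<close>.\<close>

locale sketched_objective =
  fixes f :: "real^'d \<Rightarrow> real" and LL :: "real^'d^'d"
    and M :: "'v measure" and P :: "'v \<Rightarrow> real^'r^'d"
    and \<mu> \<omega> l :: real and s :: "real^'d"
  assumes mu_pos: "0 < \<mu>" and sc: "strongly_convex \<mu> f"
    and min: "f s \<le> f v"
    and smooth: "matrix_smooth f LL"
    and sketch: "sketch_moments M P LL \<omega> l"
begin

abbreviation "L \<equiv> onorm ((*v) LL)"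
abbreviation "\<theta> \<equiv> step_theta L \<mu> \<omega> l"

definition S :: "'v \<Rightarrow> real^'d^'d" where "S w = P w ** transpose (P w)"

lemma transpose_S: "transpose (S w) = S w"
  by (simp add: S_def matrix_transpose_mul transpose_transpose)

lemma S_mult: "S w *v v = P w *v (transpose (P w) *v v)"
  by (simp only: S_def matrix_vector_mul_assoc)

lemma
  shows prob_space_M: "prob_space M" and measurable_P: "P \<in> borel_measurable M"
    and omega_pos: "0 < \<omega>" and l_pos: "0 < l"
    and integrable_S: "integrable M S" and integral_S: "(\<integral>w. S w \<partial>M) = mat 1"
    and integrable_SS: "integrable M (\<lambda>w. S w ** S w)"
    and integrable_SLS: "integrable M (\<lambda>w. S w ** LL ** S w)"
    and SS_le: "(\<integral>w. S w ** S w \<partial>M) \<preceq> mat \<omega>"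
    and SLS_le: "(\<integral>w. S w ** LL ** S w \<partial>M) \<preceq> mat (l * L)"
  using sketch unfolding sketch_moments_def Let_def S_def[abs_def, symmetric] by blast+

lemma
  shows diff: "f differentiable (at x)" and psd_LL: "psd LL"
    and smooth_le: "f y \<le> f x + gradient f x \<bullet> (y - x) + 1 / 2 * ((y - x) \<bullet> (LL *v (y - x)))"
  using smooth unfolding matrix_smooth_def by blast+

section \<open>Range of the parameter \<theta>\<close>

lemma L_pos: "0 < L"
proof -
  have "\<exists>v. LL *v v \<noteq> 0"
    using smooth unfolding matrix_smooth_def by (metis matrix_eq matrix_vector_mult_0)
  then show ?thesis
    by (simp add: onorm_pos_lt)
qed

lemma omega_ge_1: "1 \<le> \<omega>"
proof -
  let ?e = "axis undefined 1 :: real^'d"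
  \<comment> \<open>The case A = I of the Jensen-type bound, tested on a unit vector.\<close>
  have "?e \<bullet> (mat 1 *v ?e) \<le> ?e \<bullet> ((\<integral>w. S w ** mat 1 ** S w \<partial>M) *v ?e)"
    using integrable_SS by (intro psd_quadratic_le_sketched prob_space_M psd_mat_1 transpose_S
        integrable_S integral_S) simp
  also have "\<dots> \<le> \<omega> * (norm ?e)\<^sup>2"
    using loewner_le_mat_quadratic[OF SS_le, of ?e] by simp
  finally show ?thesis
    by (simp add: norm_eq_1[symmetric] power2_norm_eq_inner[symmetric])
qed

text \<open>The quadratic lower and upper models of \<open>f\<close> at \<open>s\<close> share their
  linear part; comparing them along a unit vector leaves the quadratic forms.\<close>

lemma mu_le: "\<mu> \<le> l * L"
proof -
  let ?e = "axis undefined 1 :: real^'d"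
  have "f s + gradient f s \<bullet> ?e + \<mu> / 2 * (norm ?e)\<^sup>2 \<le> f (s + ?e)"
    using strongly_convex_gradient_le[OF sc diff, of s "s + ?e"] by simp
  also have "\<dots> \<le> f s + gradient f s \<bullet> ?e + 1 / 2 * (?e \<bullet> (LL *v ?e))"
    using smooth_le[of "s + ?e" s] by simp
  finally have "\<mu> * (norm ?e)\<^sup>2 \<le> ?e \<bullet> (LL *v ?e)"
    by simp
  also have "\<dots> \<le> ?e \<bullet> ((\<integral>w. S w ** LL ** S w \<partial>M) *v ?e)"
    by (intro psd_quadratic_le_sketched prob_space_M psd_LL transpose_S
        integrable_S integral_S integrable_SLS)
  also have "\<dots> \<le> l * L * (norm ?e)\<^sup>2"
    by (rule loewner_le_mat_quadratic[OF SLS_le])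
  finally show ?thesis
    by simp
qed

lemma theta_pos: "0 < \<theta>"
  using mu_pos L_pos omega_pos l_pos by (simp add: step_theta_def)

lemma theta_le_1: "\<theta> \<le> 1"
proof -
  have "\<mu> * 1 \<le> (l * L) * \<omega>"
    using mu_le omega_ge_1 mu_pos L_pos l_pos by (intro mult_mono) simp_all
  then show ?thesis
    using L_pos omega_pos l_pos by (simp add: step_theta_def field_simps)
qed

lemma theta_square: "\<theta>\<^sup>2 * (L * \<omega> * l) = \<mu>"
  using mu_pos L_pos omega_pos l_pos by (simp add: step_theta_def)

section \<open>The potential and its contraction\<close>

definition potential :: "(real^'d) \<times> (real^'d) \<Rightarrow> real" where
  "potential t = f (fst t) - f s + \<mu> / 2 * (norm (snd t - s))\<^sup>2"

lemma gap_le_potential: "0 \<le> f (fst t) - f s" "f (fst t) - f s \<le> potential t"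
  using min mu_pos by (simp_all add: potential_def)

lemma potential_nonneg: "0 \<le> potential t"
  using gap_le_potential[of t] by linarith

text \<open>The factor 2 of the theorem: as z_0 = x_0, strong convexity at the minimizer bounds the
  distance term by the initial gap.\<close>

lemma potential_diagonal_le: "potential (x, x) \<le> 2 * (f x - f s)"
proof -
  have "gradient f s = 0"
    by (rule gradient_at_minimizer[OF diff min])
  then show ?thesis
    using strongly_convex_gradient_le[OF sc diff, of s x] by (simp add: potential_def)
qed

lemma continuous_f: "continuous_on A f"
  by (intro continuous_at_imp_continuous_on ballI differentiable_imp_continuous_within diff)

lemma borel_measurable_potential: "potential \<in> borel_measurable borel"
  unfolding potential_def[abs_def]
  by (intro borel_measurable_continuous_onI continuous_intros
      continuous_on_compose2[OF continuous_f[of UNIV]]) auto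

text \<open>With \<open>\<theta>\<^sup>2 L \<omega> l = \<mu>\<close> the gain \<open>|g|\<^sup>2 / (2 L l)\<close> of the gradient step in \<open>f\<close> cancels the
  second-order error of the update of \<open>z\<close> exactly.\<close>

lemma nn_integral_potential_step_le:
  "(\<integral>\<^sup>+w. potential (nag_step (gradient f) \<theta> (1 / (L * l)) (\<theta> / \<mu>) (P w) t) \<partial>M)
    \<le> ennreal (1 - \<theta>) * potential t"
proof -
  interpret prob_space M by (rule prob_space_M)
  define y where "y = nag_mid \<theta> t"
  define g where "g = gradient f y"
  define u where "u = (1 - \<theta>) *\<^sub>R snd t + \<theta> *\<^sub>R y"
  define a where "a = 1 / (L * l)"
  define b where "b = \<theta> / \<mu>"
  \<comment> \<open>An upper bound of the new potential that is affine in \<open>S\<close>,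
    \<open>S ** S\<close> and \<open>S ** LL ** S\<close>, so its expectation exists and is given by
    the three moments.\<close>
  define q where "q w = f y - f s - a * (g \<bullet> (S w *v g)) + a\<^sup>2 / 2 * (g \<bullet> ((S w ** LL ** S w) *v g))
      + \<mu> / 2 * ((norm (u - s))\<^sup>2 - 2 * b * ((u - s) \<bullet> (S w *v g)) + b\<^sup>2 * (g \<bullet> ((S w ** S w) *v g)))" for w
  have step_le: "potential (nag_step (gradient f) \<theta> a b (P w) t) \<le> q w" for w
  proof -
    let ?d = "S w *v g"
    have step: "nag_step (gradient f) \<theta> a b (P w) t = (y - a *\<^sub>R ?d, u - b *\<^sub>R ?d)"
      by (simp add: nag_step_def Let_def S_mult y_def g_def u_def)
    have dd: "(norm ?d)\<^sup>2 = g \<bullet> ((S w ** S w) *v g)"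
      using inner_symmetric_matrix[OF transpose_S, of g w "S w *v g"]
      by (simp add: power2_norm_eq_inner matrix_vector_mul_assoc)
    have dLd: "?d \<bullet> (LL *v ?d) = g \<bullet> ((S w ** LL ** S w) *v g)"
      using inner_symmetric_matrix[OF transpose_S, of g w "LL *v (S w *v g)"]
      by (simp add: matrix_vector_mul_assoc matrix_mul_assoc)
    have "f (y - a *\<^sub>R ?d) \<le> f y - a * (g \<bullet> ?d) + a\<^sup>2 / 2 * (?d \<bullet> (LL *v ?d))"
      using smooth_le[of "y - a *\<^sub>R ?d" y]
      by (simp add: g_def[symmetric] matrix_vector_mult_scaleR power2_eq_square
          linear_neg[OF matrix_vector_mul_linear])
    moreover have "(norm (u - b *\<^sub>R ?d - s))\<^sup>2
        = (norm (u - s))\<^sup>2 - 2 * b * ((u - s) \<bullet> ?d) + b\<^sup>2 * (norm ?d)\<^sup>2"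
      unfolding power2_norm_eq_inner
      by (simp add: inner_simps inner_commute algebra_simps power2_eq_square)
    ultimately show ?thesis
      by (simp add: step potential_def q_def dd[symmetric] dLd[symmetric])
  qed
  have q_int: "integrable M q"
    unfolding q_def[abs_def]
    by (intro Bochner_Integration.integrable_add Bochner_Integration.integrable_diff
        integrable_mult_right integrable_const integrable_quadratic_form integrable_S
        integrable_SS integrable_SLS)
  have al: "a * (l * L) = 1"
    using L_pos l_pos by (simp add: a_def)
  \<comment> \<open>The choice of \<theta> enters here: it makes \<theta>^2 \<omega> / \<mu> equal
    to the gradient step size 1 / (L l).\<close>
  have b\<omega>: "\<mu> * b\<^sup>2 * \<omega> = a"
  proof -
    have "\<mu> * b\<^sup>2 * \<omega> = \<theta>\<^sup>2 * \<omega> / \<mu>"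
      using mu_pos by (simp add: b_def power2_eq_square)
    also have "\<dots> = a"
      using theta_square mu_pos L_pos l_pos omega_pos
      by (simp add: a_def field_simps)
    finally show ?thesis .
  qed
  have "(\<integral>w. q w \<partial>M) = f y - f s - a * (g \<bullet> g)
      + a\<^sup>2 / 2 * (g \<bullet> ((\<integral>w. S w ** LL ** S w \<partial>M) *v g))
      + \<mu> / 2 * ((norm (u - s))\<^sup>2 - 2 * b * ((u - s) \<bullet> g)
        + b\<^sup>2 * (g \<bullet> ((\<integral>w. S w ** S w \<partial>M) *v g)))"
    unfolding q_def[abs_def]
    by (simp add: integrable_quadratic_form integral_quadratic_form integrable_S
        integrable_SS integrable_SLS integral_S prob_space)
  also have "\<dots> \<le> f y - f s - a * (norm g)\<^sup>2 + a\<^sup>2 / 2 * (l * L * (norm g)\<^sup>2)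
      + \<mu> / 2 * ((norm (u - s))\<^sup>2 - 2 * b * ((u - s) \<bullet> g) + b\<^sup>2 * (\<omega> * (norm g)\<^sup>2))"
    unfolding power2_norm_eq_inner[of g, symmetric]
    using mu_pos
    by (intro add_mono diff_mono mult_left_mono order_refl loewner_le_mat_quadratic SS_le SLS_le)
       simp_all
  also have "\<dots> = f y - f s + \<mu> / 2 * (norm (u - s))\<^sup>2 - (\<mu> * b) * ((u - s) \<bullet> g)
      - a * (norm g)\<^sup>2 + a * (a * (l * L)) * (norm g)\<^sup>2 / 2 + (\<mu> * b\<^sup>2 * \<omega>) * (norm g)\<^sup>2 / 2"
    by (simp add: power2_eq_square[of a] algebra_simps)
  \<comment> \<open>The coefficient of |g|^2 is -a + a/2 + a/2 = 0, and \<mu> b = \<theta>.\<close>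
  also have "\<dots> = f y - f s + \<mu> / 2 * (norm (u - s))\<^sup>2 - \<theta> * ((u - s) \<bullet> g)"
    unfolding al b\<omega> using mu_pos by (simp add: b_def)
  also have "\<dots> \<le> (1 - \<theta>) * (f (fst t) - f s + \<mu> / 2 * (norm (snd t - s))\<^sup>2)"
    using mu_pos theta_pos theta_le_1 unfolding g_def
    by (intro accelerated_step_descent strongly_convex_gradient_le sc diff)
       (simp_all add: y_def nag_mid_def u_def)
  finally have le: "(\<integral>w. q w \<partial>M) \<le> (1 - \<theta>) * potential t"
    by (simp add: potential_def)
  have q_nonneg: "0 \<le> q w" for w
    using step_le potential_nonneg by (rule order_trans[rotated])
  have "(\<integral>\<^sup>+w. potential (nag_step (gradient f) \<theta> a b (P w) t) \<partial>M) \<le> (\<integral>\<^sup>+w. q w \<partial>M)"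
    by (intro nn_integral_mono ennreal_leI step_le)
  also have "\<dots> = ennreal (\<integral>w. q w \<partial>M)"
    using q_int q_nonneg by (intro nn_integral_eq_integral) simp_all
  also have "\<dots> \<le> ennreal ((1 - \<theta>) * potential t)"
    by (rule ennreal_leI[OF le])
  also have "\<dots> = ennreal (1 - \<theta>) * potential t"
    using theta_le_1 by (simp add: ennreal_mult' potential_nonneg)
  finally show ?thesis
    by (simp add: a_def b_def)
qed

lemma expected_gap_le:
  fixes M' :: "'w measure" and Ps :: "nat \<Rightarrow> 'w \<Rightarrow> real^'r^'d"
    and x y z :: "nat \<Rightarrow> 'w \<Rightarrow> real^'d"
  assumes "prob_space M'" and copies: "iid_copies M' Ps M P"
    and algorithm: "\<And>w. w \<in> space M' \<Longrightarrow>
      rs_nag_sc (gradient f) x0 L \<mu> \<omega> l (\<lambda>k. Ps k w) (\<lambda>k. x k w) (\<lambda>k. y k w) (\<lambda>k. z k w)"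
  shows "integrable M' (\<lambda>w. f (x k w) - f s)"
    and "(\<integral>w. (f (x k w) - f s) \<partial>M') \<le> 2 * (1 - \<theta>) ^ k * (f x0 - f s)"
proof -
  interpret M': prob_space M' by fact
  let ?T = "nag_step (gradient f) \<theta> (1 / (L * l)) (\<theta> / \<mu>) :: real^'r^'d \<Rightarrow> _"
  let ?run = "\<lambda>w. random_iterate ?T (x0, x0) (\<lambda>i. Ps i w) k"
  let ?c = "2 * (1 - \<theta>) ^ k * (f x0 - f s)"
  have ind: "M'.indep_vars (\<lambda>_. borel) Ps UNIV" and law: "distr M' borel (Ps i) = distr M borel P" for i
    using copies by (auto simp: iid_copies_def)
  have T: "(\<lambda>(t, p). ?T p t) \<in> measurable (borel \<Otimes>\<^sub>M borel) borel"
    by (intro borel_measurable_nag_step borel_measurable_gradient diff)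
  have V: "(\<lambda>t. ennreal (potential t)) \<in> borel_measurable borel"
    using borel_measurable_potential by simp
  have run: "?run w = (x k w, z k w)" if "w \<in> space M'" for w
    by (rule rs_nag_sc_eq_random_iterate[OF algorithm[OF that], symmetric])
  have "(\<integral>\<^sup>+w. potential (?run w) \<partial>M') \<le> ennreal (1 - \<theta>) ^ k * potential (x0, x0)"
  proof (rule M'.nn_integral_random_iterate_le[OF T _ ind V])
    fix i and t :: "(real^'d) \<times> (real^'d)"
    have "(\<lambda>p. ennreal (potential (?T p t))) \<in> borel_measurable borel"
      using measurable_compose[OF measurable_Pair1'[of t borel borel] measurable_compose[OF T V]] by simp
    then have "(\<integral>\<^sup>+p. potential (?T p t) \<partial>distr M' borel (Ps i))
        = (\<integral>\<^sup>+w. potential (?T (P w) t) \<partial>M)"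
      unfolding law by (intro nn_integral_distr measurable_P) simp
    then show "(\<integral>\<^sup>+p. potential (?T p t) \<partial>distr M' borel (Ps i)) \<le> ennreal (1 - \<theta>) * potential t"
      using nn_integral_potential_step_le by simp
  qed simp
  also have "\<dots> = ennreal ((1 - \<theta>) ^ k * potential (x0, x0))"
    using theta_le_1 by (simp add: ennreal_mult' ennreal_power potential_nonneg)
  also have "\<dots> \<le> ennreal ?c"
    using mult_left_mono[OF potential_diagonal_le[of x0], of "(1 - \<theta>) ^ k"] theta_le_1
    by (intro ennreal_leI) (simp add: algebra_simps)
  finally have run_le: "(\<integral>\<^sup>+w. potential (?run w) \<partial>M') \<le> ennreal ?c" .
  have gap_le: "(\<integral>\<^sup>+w. ennreal (f (x k w) - f s) \<partial>M') \<le> ennreal ?c"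
  proof (rule order_trans[OF nn_integral_mono run_le])
    fix w assume "w \<in> space M'"
    then show "ennreal (f (x k w) - f s) \<le> ennreal (potential (?run w))"
      using gap_le_potential(2)[of "?run w"] run by (intro ennreal_leI) simp
  qed
  have run_meas: "?run \<in> borel_measurable M'"
    using ind by (intro M'.measurable_random_iterate[OF T]) (simp_all add: M'.indep_vars_def)
  \<comment> \<open>Measurability of \<open>x k\<close> is not assumed; it is inherited from the
    iteration, with which \<open>x k\<close> agrees on \<open>space M'\<close>.\<close>
  have "continuous_on UNIV (\<lambda>t :: (real^'d) \<times> (real^'d). f (fst t) - f s)"
    by (intro continuous_intros continuous_on_compose2[OF continuous_f[of UNIV]]) auto
  from borel_measurable_continuous_on[OF this run_meas]
  have meas: "(\<lambda>w. f (x k w) - f s) \<in> borel_measurable M'"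
    by (rule measurable_cong[THEN iffD1, rotated]) (simp add: run)
  show int: "integrable M' (\<lambda>w. f (x k w) - f s)"
    using meas gap_le min by (intro integrableI_nonneg) (auto intro: le_less_trans)
  have "ennreal (\<integral>w. (f (x k w) - f s) \<partial>M') \<le> ennreal ?c"
    using gap_le nn_integral_eq_integral[OF int] min by simp
  \<comment> \<open>\<open>ennreal\<close> sends negative reals to 0, so returning to a real
    inequality needs a nonnegative right-hand side.\<close>
  moreover have "0 \<le> ?c"
    using theta_le_1 min by simp
  ultimately show "(\<integral>w. (f (x k w) - f s) \<partial>M') \<le> ?c"
    by (simp add: ennreal_le_iff)
qed

end

section \<open>Complexity\<close>

text \<open>Uses 1 - \<theta> <= exp(-\<theta>).\<close>

lemma power_one_minus_le:
  fixes \<theta> :: real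
  assumes "0 < \<theta>" "\<theta> \<le> 1" and D: "0 < D" and \<epsilon>: "0 < \<epsilon>"
    and n: "ln (D / \<epsilon>) / \<theta> \<le> real n"
  shows "(1 - \<theta>) ^ n * D \<le> \<epsilon>"
proof -
  have "(1 - \<theta>) ^ n \<le> exp (- \<theta>) ^ n"
    using assms exp_ge_add_one_self[of "- \<theta>"] by (intro power_mono) simp_all
  also have "\<dots> = exp (- (\<theta> * real n))"
    by (simp add: exp_of_nat_mult[symmetric] mult.commute)
  also have "\<dots> \<le> exp (- ln (D / \<epsilon>))"
    using n assms by (simp add: field_simps)
  also have "\<dots> = \<epsilon> / D"
    using D \<epsilon> by (simp add: exp_minus)
  finally show ?thesis
    using D by (simp add: field_simps)
qed

text \<open>Since D / \<epsilon> >= 2, ln(2D/\<epsilon>) <= 2 ln(D/\<epsilon>). The 1 lost by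
  rounding up is at most 2 ln(D/\<epsilon>) / \<theta>, because 2 ln 2 >= 1 >= \<theta>. Together
  this gives the constant 4.\<close>

lemma nat_ceiling_log_le:
  fixes \<theta> :: real
  assumes \<theta>: "0 < \<theta>" "\<theta> \<le> 1" and \<epsilon>: "0 < \<epsilon>" "\<epsilon> \<le> D / 2"
  shows "real (nat \<lceil>ln (2 * D / \<epsilon>) / \<theta>\<rceil>) \<le> 4 * (1 / \<theta> * ln (D / \<epsilon>))"
proof -
  have D: "0 < D" and r: "2 \<le> D / \<epsilon>"
    using \<epsilon> by (simp_all add: field_simps)
  have ln2: "ln 2 \<le> ln (D / \<epsilon>)"
    using r by (subst ln_le_cancel_iff) simp_all
  have "ln (2 * D / \<epsilon>) = ln 2 + ln (D / \<epsilon>)"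
    using ln_mult[of 2 "D / \<epsilon>"] D \<epsilon> by simp
  then have 1: "ln (2 * D / \<epsilon>) / \<theta> \<le> 2 * (ln (D / \<epsilon>) / \<theta>)"
    using ln2 \<theta> by (simp add: field_simps)
  \<comment> \<open>From ln x <= x - 1 at x = 1/2.\<close>
  have half: "1 / 2 \<le> ln (2::real)"
    using ln_le_minus_one[of "1 / 2 :: real"] by (simp add: ln_div)
  then have "0 \<le> ln (2 * D / \<epsilon>) / \<theta>"
    using ln2 \<open>ln (2 * D / \<epsilon>) = ln 2 + ln (D / \<epsilon>)\<close> \<theta> by simp
  then have "real (nat \<lceil>ln (2 * D / \<epsilon>) / \<theta>\<rceil>) \<le> ln (2 * D / \<epsilon>) / \<theta> + 1"
    by linarith
  moreover have "1 \<le> 2 * (ln (D / \<epsilon>) / \<theta>)"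
  proof -
    have "\<theta> \<le> 2 * ln (D / \<epsilon>)"
      using half ln2 \<theta> by linarith
    then show ?thesis using \<theta> by (simp add: field_simps)
  qed
  ultimately show ?thesis
    using 1 by (simp add: field_simps)
qed

text \<open>The O-bounds carry the explicit constant 4, for accuracies up to half the initial gap,
  where the logarithm is at least ln 2. The accuracy holds from \<open>N\<close> onwards.\<close>

theorem theorem4p3:
  fixes f :: "real^'d \<Rightarrow> real"
    and LL :: "real^'d^'d"
    and P :: "'v \<Rightarrow> real^'r^'d"
    and Ps :: "nat \<Rightarrow> 'w \<Rightarrow> real^'r^'d"
    and M :: "'w measure" and M' :: "'v measure"
    and x y z :: "nat \<Rightarrow> 'w \<Rightarrow> real^'d"
    and x0 xstar :: "real^'d"
    and L \<mu> \<omega> l \<theta> fstar \<Delta>0 :: real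
  assumes dims: "2 \<le> CARD('d)" "1 \<le> CARD('r)" "CARD('r) \<le> CARD('d)"
    and strong_convexity: "0 < \<mu>" "strongly_convex \<mu> f"
    and minimizer: "is_arg_min f (\<lambda>_. True) xstar"
    and fstar: "fstar = f xstar"
    and smoothness: "matrix_smooth f LL"
    and L: "L = onorm ((*v) LL)"
    and sketch: "sketch_moments M' P LL \<omega> l" "l \<le> \<omega>"
    and prob: "prob_space M"
    and copies: "iid_copies M Ps M' P"
    and algorithm: "\<And>w. w \<in> space M \<Longrightarrow>
      rs_nag_sc (gradient f) x0 L \<mu> \<omega> l (\<lambda>k. Ps k w) (\<lambda>k. x k w) (\<lambda>k. y k w) (\<lambda>k. z k w)"
    and theta: "\<theta> = step_theta L \<mu> \<omega> l"
    and Delta0: "\<Delta>0 = f x0 - fstar"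
  shows "0 < \<theta> \<and> \<theta> \<le> 1 \<and>
    (\<forall>N. integrable M (\<lambda>w. f (x N w) - fstar) \<and>
         (\<integral>w. (f (x N w) - fstar) \<partial>M) \<le> 2 * (1 - \<theta>) ^ N * \<Delta>0) \<and>
    (\<forall>\<epsilon>. 0 < \<epsilon> \<and> \<epsilon> \<le> \<Delta>0 / 2 \<longrightarrow>
       (\<exists>N. (\<forall>n\<ge>N. (\<integral>w. (f (x n w) - fstar) \<partial>M) \<le> \<epsilon>) \<and>
            real N \<le> 4 * (sqrt (L * \<omega> * l / \<mu>) * ln (\<Delta>0 / \<epsilon>)) \<and>
            oracle_calls TYPE('r) N = CARD('r) * N \<and>
            real (oracle_calls TYPE('r) N)
              \<le> 4 * (sqrt (L * \<omega> * l * (real CARD('r))\<^sup>2 / \<mu>) * ln (\<Delta>0 / \<epsilon>))))"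
proof -
  \<comment> \<open>The roles of the names switch: the theorem's \<open>M'\<close> is the locale's
    \<open>M\<close>, and the run lives on the theorem's \<open>M\<close>.\<close>
  interpret sketched_objective f LL M' P \<mu> \<omega> l xstar
    using strong_convexity minimizer smoothness sketch(1)
    by unfold_locales (auto simp: is_arg_min_linorder)
  have th: "0 < \<theta>" "\<theta> \<le> 1"
    using theta_pos theta_le_1 by (simp_all add: theta L)
  have gap: "integrable M (\<lambda>w. f (x n w) - fstar)"
    "(\<integral>w. (f (x n w) - fstar) \<partial>M) \<le> 2 * (1 - \<theta>) ^ n * \<Delta>0" for n
    using expected_gap_le[OF prob copies algorithm[unfolded L], of n]
    by (simp_all add: theta L fstar Delta0)
  have inv_theta: "sqrt (L * \<omega> * l / \<mu>) = 1 / \<theta>"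
    unfolding theta step_theta_def by (simp add: real_sqrt_divide)
  have oracle_calls_eq: "oracle_calls TYPE('r) n = CARD('r) * n" for n
    by (simp add: oracle_calls_def card_cartesian_product mult.commute)
  have sqrt_r: "sqrt (L * \<omega> * l * (real CARD('r))\<^sup>2 / \<mu>) = real CARD('r) * (1 / \<theta>)"
    by (simp add: inv_theta[symmetric] real_sqrt_mult real_sqrt_divide)
  have complexity: "\<exists>N. (\<forall>n\<ge>N. (\<integral>w. (f (x n w) - fstar) \<partial>M) \<le> \<epsilon>) \<and>
      real N \<le> 4 * (1 / \<theta> * ln (\<Delta>0 / \<epsilon>))" if \<epsilon>: "0 < \<epsilon>" "\<epsilon> \<le> \<Delta>0 / 2" for \<epsilon>
  proof (intro exI conjI allI impI)
    let ?N = "nat \<lceil>ln (2 * \<Delta>0 / \<epsilon>) / \<theta>\<rceil>"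
    show "real ?N \<le> 4 * (1 / \<theta> * ln (\<Delta>0 / \<epsilon>))"
      by (rule nat_ceiling_log_le[OF th \<epsilon>])
    fix n assume "?N \<le> n"
    then have "ln (2 * \<Delta>0 / \<epsilon>) / \<theta> \<le> real n"
      by linarith
    \<comment> \<open>Applied with D = 2 \<Delta>0, which is why \<open>?N\<close> has the factor 2
      inside the logarithm.\<close>
    then have "(1 - \<theta>) ^ n * (2 * \<Delta>0) \<le> \<epsilon>"
      using th \<epsilon> by (intro power_one_minus_le) simp_all
    then show "(\<integral>w. (f (x n w) - fstar) \<partial>M) \<le> \<epsilon>"
      using gap(2)[of n] by (simp add: mult_ac)
  qed
  have calls: "real (oracle_calls TYPE('r) N) \<le> 4 * (real CARD('r) * (1 / \<theta>) * ln (\<Delta>0 / \<epsilon>))"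
    if "real N \<le> 4 * (1 / \<theta> * ln (\<Delta>0 / \<epsilon>))" for N \<epsilon>
    using mult_left_mono[OF that, of "real CARD('r)"] by (simp add: oracle_calls_eq mult_ac)
  show ?thesis
    unfolding inv_theta sqrt_r using th gap complexity oracle_calls_eq calls by blast
qed

end
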